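(* Let $\Sigma=(K,arity)$ be a signature and let $S$ be a multi-set over the relation symbols of the bigraph relational model. If $S$ is valid, then there exists a bigraph $B$ (under $\Sigma$) such that $[\![B]\!]=S$.
   Context: **Bigraphs.** A signature is $\Sigma=(K,arity)$ with $K$ a set of controls and $arity:K\to\mathbb N$. A bigraph under $\Sigma$ is $B=(V_B,E_B,P_B,ctrl_B,prnt_B,link_B):\langle m,X\rangle\to\langle n,Y\rangle$, where $m,n$ are finite ordinals (the sites, resp. roots), $X,Y,V_B,E_B$ are finite sets (inner names, outer names, nodes, edges), $ctrl_B:V_B\to K$, $P_B=\{(v,i)\mid v\in V_B,\ i\in arity(ctrl_B\,v)\}$ (ports; a natural number is the set of smaller numbers), $prnt_B:V_B\cup m\to V_B\cup n$ is total and establishes a tree-shaped (acyclic) parent ordering on the nodes, and $link_B:X\cup P_B\to E_B\cup Y$ is total. The sets $m,n,X,Y,V_B,E_B$ are assumed disjoint. **Relation symbols.** Elements of the multi-sets are facts built from names of the disjoint sorts node, root, site, port, o_name, i_name, e_name, and from controls and natural numbers in unary ($\mathtt z$, $\mathtt s\,N$). Destinations in the place graph are $\mathtt{dst\_n}\,a$ ($a$ a node), $\mathtt{dst\_r}\,r$ ($r$ a root); sources are $\mathtt{src\_n}\,a$, $\mathtt{src\_s}\,s$ ($s$ a site). In the link graph destinations are $\mathtt{dst\_o}\,o$ ($o$ an outer name), $\mathtt{dst\_e}\,e$ ($e$ an edge), and sources are $\mathtt{src\_i}\,i$ ($i$ an inner name), $\mathtt{src\_p}\,p$ ($p$ a port).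 The facts are: structural facts is_root $r$, is_node $a$, is_site $s$, is_port $p$, is_o_name $o$, is_i_name $i$, is_e_name $e$; operational facts prnt $S\,D$, link $S\,D$ ($S$ a source, $D$ a destination), lc $a\,k$ (node $a$ has control $k$), lp $p\,a$ (port $p$ belongs to node $a$), has_child_p $D\,N$, has_child_l $D\,N$, vp $a\,N$ ($a$ a node, $N$ a natural number). (The paper's extra argument naming the bigraph is omitted.) **Rewrite rules.** $\Delta$ is an arbitrary multi-set, upper-case letters are variables: (dr) {is_root $R$, has_child_p (dst_r $R$) z} $\uplus\Delta\mapsto\Delta$. (do) {is_o_name $O$, has_child_l (dst_o $O$) z} $\uplus\Delta\mapsto\Delta$. (de) {is_e_name $E$, has_child_l (dst_e $E$) z} $\uplus\Delta\mapsto\Delta$. (lgpsz) {is_port $P$, lp $P\,A$, vp $A$ (s z), link (src_p $P$) $D$, has_child_l $D$ (s $N$)} $\uplus\Delta\mapsto$ {has_child_l $D\,N$} $\uplus\Delta$. (lgi) {is_i_name $I$, link (src_i $I$) $D$, has_child_l $D$ (s $N$)} $\uplus\Delta\mapsto$ {has_child_l $D\,N$} $\uplus\Delta$. (lgs) {is_site $S$, prnt (src_s $S$) $D$, has_child_p $D$ (s $N$)} $\uplus\Delta\mapsto$ {has_child_p $D\,N$} $\uplus\Delta$. (pgnz) {is_node $A$, has_child_p (dst_n $A$) z, prnt (src_n $A$) $D$, has_child_p $D$ (s $N$), lc $A\,K$} $\uplus\Delta\mapsto$ {has_child_p $D\,N$} $\uplus\Delta$, if $arity\,K=0$. (pgns)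 {is_node $A$, has_child_p (dst_n $A$) z, prnt (src_n $A$) $D$, has_child_p $D$ (s $N$), lc $A\,K$} $\uplus\Delta\mapsto$ {has_child_p $D\,N$, vp $A\,N'$} $\uplus\Delta$, if $arity\,K=N'>0$. (lgps) {is_port $P$, lp $P\,A$, vp $A$ (s (s $N'$)), link (src_p $P$) $D$, has_child_l $D$ (s $N$)} $\uplus\Delta\mapsto$ {vp $A$ (s $N'$), has_child_l $D\,N$} $\uplus\Delta$. $S\longrightarrow S'$ denotes the reflexive-transitive closure of $\mapsto$. **Validity.** $S$ is valid iff $S\longrightarrow\emptyset$, every element of $S$ has multiplicity one, and each of has_child_p, has_child_l, vp is unique in its first argument in $S$ (for each first argument $D$, in node $\cup$ root, o_name $\cup$ e_name, node respectively, there is at most one such fact in $S$). **Encoding.** Names are chosen injectively for the nodes, edges, ports, roots, sites, inner and outer names of $B$ (the names of different sorts being distinct); an element and its name are written alike. $[\![B]\!]$ is the multi-set in which each of the following occurs exactly once: is_root $r$, has_child_p (dst_r $r$) $|prnt_B^{-1}(r)|$ for each root $r\in n$; is_node $v$, lc $v$ $(ctrl_B\,v)$, has_child_p (dst_n $v$) $|prnt_B^{-1}(v)|$, prnt (src_n $v$) $(prnt_B\,v)$ for each $v\in V_B$; is_site $s$, prnt (src_s $s$) $(prnt_B\,s)$ for each site $s\in m$; is_port $p$, lp $p\,v$, link (src_p $p$) $(link_B\,p)$ for each port $p=(v,i)\in P_B$; is_o_name $o$, has_child_l (dst_o $o$) $|link_B^{-1}(o)|$ for each $o\in Y$; is_e_name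 $e$, has_child_l (dst_e $e$) $|link_B^{-1}(e)|$ for each $e\in E_B$; is_i_name $x$, link (src_i $x$) $(link_B\,x)$ for each $x\in X$. Here $prnt_B\,v$, $link_B\,p$ etc. carry the appropriate constructor dst_n, dst_r, dst_o, dst_e. The equation $[\![B]\!]=S$ is understood for a suitable choice of the names.
   Formalization: The formal theorem additionally assumes that S contains no vp facts; without this the claim fails: {is_port p, lp p a, vp a (s z), link (src_p p) (dst_o y), has_child_l (dst_o y) (s z), is_o_name y} is valid, but no encoding contains a vp fact. *)

theory Defs
  imports Main "HOL-Library.Multiset"
begin

section \<open>Bigraphs\<close>

record 'k signature =
  controls :: "'k set"
  arity :: "'k \<Rightarrow> nat"

(* The disjointness of m, n, X, Y, V, E is built in by using sum types for the unions
   V + m, V + n, X + P and E + Y; the ordinal m is {..<m}. *)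
record ('v, 'e, 'x, 'y, 'k) bigraph =
  num_sites :: nat
  num_roots :: nat
  inner_names :: "'x set"
  outer_names :: "'y set"
  nodes :: "'v set"
  edges :: "'e set"
  ctrl_map :: "'v \<Rightarrow> 'k"
  prnt_map :: "'v + nat \<Rightarrow> 'v + nat"
  link_map :: "'x + ('v \<times> nat) \<Rightarrow> 'e + 'y"

definition ports :: "'k signature \<Rightarrow> ('v, 'e, 'x, 'y, 'k) bigraph \<Rightarrow> ('v \<times> nat) set" where
  "ports \<Sigma> B = {(v, i). v \<in> nodes B \<and> i < arity \<Sigma> (ctrl_map B v)}"

definition is_bigraph :: "'k signature \<Rightarrow> ('v, 'e, 'x, 'y, 'k) bigraph \<Rightarrow> bool" where
  "is_bigraph \<Sigma> B \<longleftrightarrow>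
     finite (inner_names B) \<and> finite (outer_names B) \<and> finite (nodes B) \<and> finite (edges B) \<and>
     (\<forall>v \<in> nodes B. ctrl_map B v \<in> controls \<Sigma>) \<and>
     (\<forall>w \<in> nodes B <+> {..<num_sites B}. prnt_map B w \<in> nodes B <+> {..<num_roots B}) \<and>
     acyclic {(v, u). v \<in> nodes B \<and> u \<in> nodes B \<and> prnt_map B (Inl v) = Inl u} \<and>
     (\<forall>q \<in> inner_names B <+> ports \<Sigma> B. link_map B q \<in> edges B <+> outer_names B)"

definition prnt_preimage :: "('v, 'e, 'x, 'y, 'k) bigraph \<Rightarrow> 'v + nat \<Rightarrow> ('v + nat) set" where
  "prnt_preimage B d = {w \<in> nodes B <+> {..<num_sites B}. prnt_map B w = d}"

definition link_preimage ::
  "'k signature \<Rightarrow> ('v, 'e, 'x, 'y, 'k) bigraph \<Rightarrow> 'e + 'y \<Rightarrow> ('x + ('v \<times> nat)) set" where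
  "link_preimage \<Sigma> B d = {q \<in> inner_names B <+> ports \<Sigma> B. link_map B q = d}"

section \<open>Facts\<close>

(* Each sort of names is a type parameter: 'nd nodes, 'rt roots, 'st sites, 'pt ports,
   'on outer names, 'im inner names, 'ed edges; 'k is the type of controls.
   Unary numbers are rendered by nat, with z as 0 and s as Suc. *)
datatype ('nd, 'rt) place_dst = dst_n 'nd | dst_r 'rt
datatype ('nd, 'st) place_src = src_n 'nd | src_s 'st
datatype ('on, 'ed) link_dst = dst_o 'on | dst_e 'ed
datatype ('im, 'pt) link_src = src_i 'im | src_p 'pt

datatype ('nd, 'rt, 'st, 'pt, 'on, 'im, 'ed, 'k) fact =
    is_root 'rt
  | is_node 'nd
  | is_site 'st
  | is_port 'pt
  | is_o_name 'on
  | is_i_name 'im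
  | is_e_name 'ed
  | prnt "('nd, 'st) place_src" "('nd, 'rt) place_dst"
  | link "('im, 'pt) link_src" "('on, 'ed) link_dst"
  | lc 'nd 'k
  | lp 'pt 'nd
  | has_child_p "('nd, 'rt) place_dst" nat
  | has_child_l "('on, 'ed) link_dst" nat
  | vp 'nd nat

definition over_signature ::
  "'k signature \<Rightarrow> ('nd, 'rt, 'st, 'pt, 'on, 'im, 'ed, 'k) fact multiset \<Rightarrow> bool" where
  "over_signature \<Sigma> S \<longleftrightarrow> (\<forall>a k. lc a k \<in># S \<longrightarrow> k \<in> controls \<Sigma>)"

section \<open>Rewriting and validity\<close>

inductive rewrite ::
  "'k signature \<Rightarrow> ('nd, 'rt, 'st, 'pt, 'on, 'im, 'ed, 'k) fact multiset \<Rightarrow>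
    ('nd, 'rt, 'st, 'pt, 'on, 'im, 'ed, 'k) fact multiset \<Rightarrow> bool"
  for \<Sigma> :: "'k signature"
where
  dr: "rewrite \<Sigma> ({#is_root r, has_child_p (dst_r r) 0#} + \<Delta>) \<Delta>"
| do: "rewrite \<Sigma> ({#is_o_name y, has_child_l (dst_o y) 0#} + \<Delta>) \<Delta>"
| de: "rewrite \<Sigma> ({#is_e_name e, has_child_l (dst_e e) 0#} + \<Delta>) \<Delta>"
| lgpsz: "rewrite \<Sigma>
    ({#is_port p, lp p a, vp a (Suc 0), link (src_p p) d, has_child_l d (Suc n)#} + \<Delta>)
    ({#has_child_l d n#} + \<Delta>)"
| lgi: "rewrite \<Sigma>
    ({#is_i_name x, link (src_i x) d, has_child_l d (Suc n)#} + \<Delta>)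
    ({#has_child_l d n#} + \<Delta>)"
| lgs: "rewrite \<Sigma>
    ({#is_site t, prnt (src_s t) d, has_child_p d (Suc n)#} + \<Delta>)
    ({#has_child_p d n#} + \<Delta>)"
| pgnz: "arity \<Sigma> k = 0 \<Longrightarrow> rewrite \<Sigma>
    ({#is_node a, has_child_p (dst_n a) 0, prnt (src_n a) d, has_child_p d (Suc n), lc a k#} + \<Delta>)
    ({#has_child_p d n#} + \<Delta>)"
| pgns: "arity \<Sigma> k = n' \<Longrightarrow> n' > 0 \<Longrightarrow> rewrite \<Sigma>
    ({#is_node a, has_child_p (dst_n a) 0, prnt (src_n a) d, has_child_p d (Suc n), lc a k#} + \<Delta>)
    ({#has_child_p d n, vp a n'#} + \<Delta>)"
| lgps: "rewrite \<Sigma>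
    ({#is_port p, lp p a, vp a (Suc (Suc n')), link (src_p p) d, has_child_l d (Suc n)#} + \<Delta>)
    ({#vp a (Suc n'), has_child_l d n#} + \<Delta>)"

definition valid ::
  "'k signature \<Rightarrow> ('nd, 'rt, 'st, 'pt, 'on, 'im, 'ed, 'k) fact multiset \<Rightarrow> bool" where
  "valid \<Sigma> S \<longleftrightarrow>
     (rewrite \<Sigma>)\<^sup>*\<^sup>* S {#} \<and>
     (\<forall>f \<in># S. count S f = 1) \<and>
     (\<forall>d n n'. has_child_p d n \<in># S \<and> has_child_p d n' \<in># S \<longrightarrow> n = n') \<and>
     (\<forall>d n n'. has_child_l d n \<in># S \<and> has_child_l d n' \<in># S \<longrightarrow> n = n') \<and>
     (\<forall>a n n'. vp a n \<in># S \<and> vp a n' \<in># S \<longrightarrow> n = n')"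

section \<open>Encoding\<close>

record ('v, 'e, 'x, 'y, 'nd, 'rt, 'st, 'pt, 'on, 'im, 'ed) naming =
  node_name :: "'v \<Rightarrow> 'nd"
  root_name :: "nat \<Rightarrow> 'rt"
  site_name :: "nat \<Rightarrow> 'st"
  port_name :: "'v \<times> nat \<Rightarrow> 'pt"
  outer_name :: "'y \<Rightarrow> 'on"
  inner_name :: "'x \<Rightarrow> 'im"
  edge_name :: "'e \<Rightarrow> 'ed"

definition injective_naming ::
  "'k signature \<Rightarrow> ('v, 'e, 'x, 'y, 'k) bigraph \<Rightarrow>
    ('v, 'e, 'x, 'y, 'nd, 'rt, 'st, 'pt, 'on, 'im, 'ed) naming \<Rightarrow> bool" where
  "injective_naming \<Sigma> B \<nu> \<longleftrightarrow>
     inj_on (node_name \<nu>) (nodes B) \<and>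
     inj_on (root_name \<nu>) {..<num_roots B} \<and>
     inj_on (site_name \<nu>) {..<num_sites B} \<and>
     inj_on (port_name \<nu>) (ports \<Sigma> B) \<and>
     inj_on (outer_name \<nu>) (outer_names B) \<and>
     inj_on (inner_name \<nu>) (inner_names B) \<and>
     inj_on (edge_name \<nu>) (edges B)"

definition name_place_dst ::
  "('v, 'e, 'x, 'y, 'nd, 'rt, 'st, 'pt, 'on, 'im, 'ed) naming \<Rightarrow>
    'v + nat \<Rightarrow> ('nd, 'rt) place_dst" where
  "name_place_dst \<nu> d = (case d of Inl v \<Rightarrow> dst_n (node_name \<nu> v) | Inr r \<Rightarrow> dst_r (root_name \<nu> r))"

definition name_link_dst ::
  "('v, 'e, 'x, 'y, 'nd, 'rt, 'st, 'pt, 'on, 'im, 'ed) naming \<Rightarrow>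
    'e + 'y \<Rightarrow> ('on, 'ed) link_dst" where
  "name_link_dst \<nu> d = (case d of Inl e \<Rightarrow> dst_e (edge_name \<nu> e) | Inr y \<Rightarrow> dst_o (outer_name \<nu> y))"

definition encoding_facts ::
  "'k signature \<Rightarrow> ('v, 'e, 'x, 'y, 'nd, 'rt, 'st, 'pt, 'on, 'im, 'ed) naming \<Rightarrow>
    ('v, 'e, 'x, 'y, 'k) bigraph \<Rightarrow> ('nd, 'rt, 'st, 'pt, 'on, 'im, 'ed, 'k) fact set" where
  "encoding_facts \<Sigma> \<nu> B =
     (\<Union>r \<in> {..<num_roots B}.
        {is_root (root_name \<nu> r),
         has_child_p (dst_r (root_name \<nu> r)) (card (prnt_preimage B (Inr r)))}) \<union>
     (\<Union>v \<in> nodes B.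
        {is_node (node_name \<nu> v),
         lc (node_name \<nu> v) (ctrl_map B v),
         has_child_p (dst_n (node_name \<nu> v)) (card (prnt_preimage B (Inl v))),
         prnt (src_n (node_name \<nu> v)) (name_place_dst \<nu> (prnt_map B (Inl v)))}) \<union>
     (\<Union>t \<in> {..<num_sites B}.
        {is_site (site_name \<nu> t),
         prnt (src_s (site_name \<nu> t)) (name_place_dst \<nu> (prnt_map B (Inr t)))}) \<union>
     (\<Union>(v, i) \<in> ports \<Sigma> B.
        {is_port (port_name \<nu> (v, i)),
         lp (port_name \<nu> (v, i)) (node_name \<nu> v),
         link (src_p (port_name \<nu> (v, i))) (name_link_dst \<nu> (link_map B (Inr (v, i))))}) \<union>
     (\<Union>y \<in> outer_names B.
        {is_o_name (outer_name \<nu> y),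
         has_child_l (dst_o (outer_name \<nu> y)) (card (link_preimage \<Sigma> B (Inr y)))}) \<union>
     (\<Union>e \<in> edges B.
        {is_e_name (edge_name \<nu> e),
         has_child_l (dst_e (edge_name \<nu> e)) (card (link_preimage \<Sigma> B (Inl e)))}) \<union>
     (\<Union>x \<in> inner_names B.
        {is_i_name (inner_name \<nu> x),
         link (src_i (inner_name \<nu> x)) (name_link_dst \<nu> (link_map B (Inl x)))})"

(* Each fact occurs exactly once; for an actual bigraph the set is finite, as mset_set needs. *)
definition encoding ::
  "'k signature \<Rightarrow> ('v, 'e, 'x, 'y, 'nd, 'rt, 'st, 'pt, 'on, 'im, 'ed) naming \<Rightarrow>
    ('v, 'e, 'x, 'y, 'k) bigraph \<Rightarrow> ('nd, 'rt, 'st, 'pt, 'on, 'im, 'ed, 'k) fact multiset" where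
  "encoding \<Sigma> \<nu> B = mset_set (encoding_facts \<Sigma> \<nu> B)"

section \<open>The role of vp\<close>

(* vp is a counter created by pgns and consumed by lgps and lgpsz; no encoding contains it.
   Validity does not exclude vp facts from S itself, and a valid S containing one need not
   be an encoding, so inverting the encoding requires S to be free of vp. *)
lemma vp_notin_encoding: "vp a n \<notin># encoding \<Sigma> \<nu> B"
proof -
  have "vp a n \<notin> encoding_facts \<Sigma> \<nu> B"
    by (auto simp: encoding_facts_def)
  then show ?thesis
    unfolding encoding_def
    by (metis elem_mset_set mset_set.infinite set_mset_empty empty_iff)
qed

lemma valid_not_encoding:
  fixes \<Sigma> :: "'k signature"
    and S :: "('nd, 'rt, 'st, 'pt, 'on, 'im, 'ed, 'k) fact multiset"
  assumes S: "S = {#is_port p, lp p a, vp a (Suc 0), link (src_p p) (dst_o y),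
                    has_child_l (dst_o y) (Suc 0), is_o_name y#}"
  shows "over_signature \<Sigma> S" and "valid \<Sigma> S" and "encoding \<Sigma> \<nu> B \<noteq> S"
proof -
  show "over_signature \<Sigma> S"
    by (simp add: over_signature_def S)
  have "rewrite \<Sigma> S {#has_child_l (dst_o y) 0, is_o_name y#}"
    using lgpsz[of \<Sigma> p a "dst_o y" 0 "{#is_o_name y#}"] by (simp add: S add_mset_commute)
  moreover have "rewrite \<Sigma> {#has_child_l (dst_o y) 0, is_o_name y#} {#}"
    using do[of \<Sigma> y "{#}"] by (simp add: add_mset_commute)
  ultimately have "(rewrite \<Sigma>)\<^sup>*\<^sup>* S {#}"
    by (meson converse_rtranclp_into_rtranclp rtranclp.rtrancl_refl)
  then show "valid \<Sigma> S"
    by (auto simp: valid_def S)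
  show "encoding \<Sigma> \<nu> B \<noteq> S"
    using vp_notin_encoding[of a "Suc 0" \<Sigma> \<nu> B] by (auto simp: S)
qed

end

theory Submission
  imports Defs
begin

text \<open>Every rewrite rule preserves a family of linear identities between numbers of facts, and these
  hold for the empty multiset. So each node of \<open>S\<close> has exactly one parent fact, one control fact and
  one child counter, each counter equals the number of facts that it counts, and each node has as
  many ports as its arity demands. A node is erased only when its counter is zero, that is, before
  its parent, so the parent relation is acyclic.\<close>

section \<open>Linear invariants of rewriting\<close>

text \<open>The structural fact that declares the element named by a reference. With these four maps
  one identity covers, for instance, nodes and roots alike.\<close>

primrec place_dst_fact ::
  "('nd, 'rt) place_dst \<Rightarrow> ('nd, 'rt, 'st, 'pt, 'on, 'im, 'ed, 'k) fact" where
  "place_dst_fact (dst_n a) = is_node a"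
| "place_dst_fact (dst_r r) = is_root r"

primrec place_src_fact ::
  "('nd, 'st) place_src \<Rightarrow> ('nd, 'rt, 'st, 'pt, 'on, 'im, 'ed, 'k) fact" where
  "place_src_fact (src_n a) = is_node a"
| "place_src_fact (src_s t) = is_site t"

primrec link_dst_fact ::
  "('on, 'ed) link_dst \<Rightarrow> ('nd, 'rt, 'st, 'pt, 'on, 'im, 'ed, 'k) fact" where
  "link_dst_fact (dst_o y) = is_o_name y"
| "link_dst_fact (dst_e e) = is_e_name e"

primrec link_src_fact ::
  "('im, 'pt) link_src \<Rightarrow> ('nd, 'rt, 'st, 'pt, 'on, 'im, 'ed, 'k) fact" where
  "link_src_fact (src_i x) = is_i_name x"
| "link_src_fact (src_p p) = is_port p"

text \<open>Summed over a multi-set, this totals the counters at \<open>d\<close>. A rule that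
  removes a \<open>prnt\<close> fact into \<open>d\<close> lowers the total by one.\<close>

fun place_weight ::
  "('nd, 'rt) place_dst \<Rightarrow> ('nd, 'rt, 'st, 'pt, 'on, 'im, 'ed, 'k) fact \<Rightarrow> nat" where
  "place_weight d (has_child_p d' n) = (if d = d' then n else 0)"
| "place_weight d _ = 0"

fun link_weight ::
  "('on, 'ed) link_dst \<Rightarrow> ('nd, 'rt, 'st, 'pt, 'on, 'im, 'ed, 'k) fact \<Rightarrow> nat" where
  "link_weight d (has_child_l d' n) = (if d = d' then n else 0)"
| "link_weight d _ = 0"

text \<open>A node still to be erased promises as many ports as its arity; \<open>vp\<close> takes over this promise
  once the node is gone.\<close>
fun port_weight ::
  "'k signature \<Rightarrow> 'nd \<Rightarrow> ('nd, 'rt, 'st, 'pt, 'on, 'im, 'ed, 'k) fact \<Rightarrow> nat" where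
  "port_weight \<Sigma> a (lc a' k) = (if a = a' then arity \<Sigma> k else 0)"
| "port_weight \<Sigma> a (vp a' n) = (if a = a' then n else 0)"
| "port_weight \<Sigma> a _ = 0"

text \<open>All identities are bundled for fixed arguments, so that a single pass over the rules
  proves them. Sizes count multiplicities, since the multi-sets met during rewriting are not assumed
  to be sets.\<close>

definition balanced ::
  "'k signature \<Rightarrow> ('nd, 'rt) place_dst \<Rightarrow> ('nd, 'st) place_src \<Rightarrow> ('on, 'ed) link_dst \<Rightarrow>
    ('im, 'pt) link_src \<Rightarrow> 'nd \<Rightarrow> 'pt \<Rightarrow>
    ('nd, 'rt, 'st, 'pt, 'on, 'im, 'ed, 'k) fact multiset \<Rightarrow> bool" where
  "balanced \<Sigma> d s d' s' a p S \<longleftrightarrow>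
     size {#f \<in># S. f \<in> range (has_child_p d)#} = count S (place_dst_fact d) \<and>
     size {#f \<in># S. f \<in> range (prnt s)#} = count S (place_src_fact s) \<and>
     size {#f \<in># S. f \<in> range (has_child_l d')#} = count S (link_dst_fact d') \<and>
     size {#f \<in># S. f \<in> range (link s')#} = count S (link_src_fact s') \<and>
     size {#f \<in># S. f \<in> range (lc a)#} = count S (is_node a) \<and>
     size {#f \<in># S. f \<in> range (lp p)#} = count S (is_port p) \<and>
     size {#f \<in># S. f \<in> range (\<lambda>s. prnt s d)#} = (\<Sum>f\<in>#S. place_weight d f) \<and>
     size {#f \<in># S. f \<in> range (\<lambda>s. link s d')#} = (\<Sum>f\<in>#S. link_weight d' f) \<and>
     size {#f \<in># S. f \<in> range (\<lambda>p. lp p a)#} = (\<Sum>f\<in>#S. port_weight \<Sigma> a f)"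

text \<open>Lets the simplifier compare the structural fact of a variable reference with the
  concrete facts occurring in a rule.\<close>

lemma place_dst_fact_eq:
  "place_dst_fact d = f \<longleftrightarrow> (case f of is_node a \<Rightarrow> d = dst_n a | is_root r \<Rightarrow> d = dst_r r | _ \<Rightarrow> False)"
  by (cases d; cases f) auto

lemma place_src_fact_eq:
  "place_src_fact s = f \<longleftrightarrow> (case f of is_node a \<Rightarrow> s = src_n a | is_site t \<Rightarrow> s = src_s t | _ \<Rightarrow> False)"
  by (cases s; cases f) auto

lemma link_dst_fact_eq:
  "link_dst_fact d = f \<longleftrightarrow> (case f of is_o_name y \<Rightarrow> d = dst_o y | is_e_name e \<Rightarrow> d = dst_e e | _ \<Rightarrow> False)"
  by (cases d; cases f) auto

lemma link_src_fact_eq: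
  "link_src_fact s = f \<longleftrightarrow> (case f of is_i_name x \<Rightarrow> s = src_i x | is_port p \<Rightarrow> s = src_p p | _ \<Rightarrow> False)"
  by (cases s; cases f) auto

lemmas ref_fact_eqs = place_dst_fact_eq place_src_fact_eq link_dst_fact_eq link_src_fact_eq

text \<open>Each rule changes both sides of every identity by the same amount. The direction is from
  \<open>S'\<close> back to \<open>S\<close> because the identities are known at the end of the
  rewriting, for \<open>{#}\<close>.\<close>

lemma balanced_rewrite:
  assumes "rewrite \<Sigma> S S'" and "balanced \<Sigma> d s d' s' a p S'"
  shows "balanced \<Sigma> d s d' s' a p S"
  using assms(1)
proof cases
\<comment> \<open>The equations are supplied in both orientations, since comparisons with a
  structural fact may arise either way round.\<close>
qed (use assms(2) in \<open>auto simp: balanced_def image_iff ref_fact_eqs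
       ref_fact_eqs[THEN trans[OF eq_commute]] split: if_splits\<close>)

lemma balanced_if_erasable:
  assumes "(rewrite \<Sigma>)\<^sup>*\<^sup>* S {#}"
  shows "balanced \<Sigma> d s d' s' a p S"
  using assms
proof (induction rule: converse_rtranclp_induct)
  case base
  show ?case by (simp add: balanced_def)
next
  case (step S S')
  then show ?case by (blast intro: balanced_rewrite)
qed

lemma
  fixes S :: "('nd, 'rt, 'st, 'pt, 'on, 'im, 'ed, 'k) fact multiset"
  assumes "(rewrite \<Sigma>)\<^sup>*\<^sup>* S {#}"
  shows has_child_p_count: "size {#f \<in># S. f \<in> range (has_child_p d)#} = count S (place_dst_fact d)"
    and prnt_count: "size {#f \<in># S. f \<in> range (prnt s)#} = count S (place_src_fact s)"
    and has_child_l_count: "size {#f \<in># S. f \<in> range (has_child_l d')#} = count S (link_dst_fact d')"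
    and link_count: "size {#f \<in># S. f \<in> range (link s')#} = count S (link_src_fact s')"
    and lc_count: "size {#f \<in># S. f \<in> range (lc a)#} = count S (is_node a)"
    and lp_count: "size {#f \<in># S. f \<in> range (lp p)#} = count S (is_port p)"
    and place_weight_sum:
      "size {#f \<in># S. f \<in> range (\<lambda>s. prnt s d)#} = (\<Sum>f\<in>#S. place_weight d f)"
    and link_weight_sum:
      "size {#f \<in># S. f \<in> range (\<lambda>s. link s d')#} = (\<Sum>f\<in>#S. link_weight d' f)"
    and port_weight_sum:
      "size {#f \<in># S. f \<in> range (\<lambda>p. lp p a)#} = (\<Sum>f\<in>#S. port_weight \<Sigma> a f)"
  using balanced_if_erasable[OF assms, of d s d' s' a p] by (simp_all only: balanced_def)

lemma sum_mset_only:
  fixes w :: "'a \<Rightarrow> 'b :: comm_monoid_add"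
  assumes "f \<in># S" "count S f = 1" "\<And>g. g \<in># S \<Longrightarrow> g \<noteq> f \<Longrightarrow> w g = 0"
  shows "(\<Sum>g\<in>#S. w g) = w f"
proof -
  obtain \<Delta> where \<Delta>: "S = add_mset f \<Delta>"
    using assms(1) by (meson multi_member_split)
  then have "f \<notin># \<Delta>"
    using assms(2) by (simp add: not_in_iff)
  then have "w g = 0" if "g \<in># \<Delta>" for g
    using assms(3)[of g] that by (auto simp: \<Delta>)
  then have "(\<Sum>g\<in>#\<Delta>. w g) = 0"
    by (simp cong: image_mset_cong)
  then show ?thesis
    by (simp add: \<Delta>)
qed

section \<open>Acyclicity of the parent relation\<close>

text \<open>There are as many counters at \<open>a\<close> as declarations of \<open>a\<close>, so
  the zero counter is the only one and the total weight at \<open>a\<close> vanishes. Bounding only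
  \<open>is_node\<close> makes the lemma applicable along the rewriting, where full validity is not
  at hand.\<close>

lemma childless_if_zero_counter:
  assumes "(rewrite \<Sigma>)\<^sup>*\<^sup>* S {#}" "count S (is_node a) \<le> 1" "has_child_p (dst_n a) 0 \<in># S"
  shows "prnt s (dst_n a) \<notin># S"
proof -
  obtain \<Delta> where S: "S = add_mset (has_child_p (dst_n a) 0) \<Delta>"
    using assms(3) by (meson multi_member_split)
  note count = has_child_p_count[OF assms(1), of "dst_n a"]
  note weight = place_weight_sum[OF assms(1), of "dst_n a"]
  have "Suc (size {#f \<in># \<Delta>. f \<in> range (has_child_p (dst_n a))#}) = count S (is_node a)"
    using count by (simp add: S)
  then have "size {#f \<in># \<Delta>. f \<in> range (has_child_p (dst_n a))#} = 0"
    using assms(2) by linarith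
  then have "place_weight (dst_n a) f = 0" if "f \<in># \<Delta>" for f
    using that by (cases f) auto
  then have "(\<Sum>f\<in>#S. place_weight (dst_n a) f) = 0"
    by (simp add: S cong: image_mset_cong)
  with weight have "size {#f \<in># S. f \<in> range (\<lambda>s. prnt s (dst_n a))#} = 0"
    by (simp only:)
  then show ?thesis
    by auto
qed

text \<open>Going backwards from \<open>{#}\<close>, a rule restores at most one edge between nodes,
  and that edge starts at a node without children.\<close>

lemma acyclic_parents:
  assumes "(rewrite \<Sigma>)\<^sup>*\<^sup>* S {#}" "\<And>a. count S (is_node a) \<le> 1"
  shows "acyclic {(v, u). prnt (src_n v) (dst_n u) \<in># S}"
  using assms
proof (induction rule: converse_rtranclp_induct)
  case base
  show ?case by (simp add: acyclic_def)
next
  case (step S S')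
  let ?R = "\<lambda>S. {(v, u). prnt (src_n v) (dst_n u) \<in># S}"
  \<comment> \<open>No rule creates a node, so the bound on \<open>S\<close> passes to
    \<open>S'\<close>.\<close>
  have "count S' (is_node a) \<le> count S (is_node a)" for a
    using step.hyps(1) by cases auto
  then have IH: "acyclic (?R S')"
    using step.IH step.prems le_trans by blast
  \<comment> \<open>Common to \<open>pgnz\<close> and \<open>pgns\<close>; a root as parent adds no
    edge between nodes.\<close>
  have erase: "acyclic (?R S)"
    if "has_child_p (dst_n a) 0 \<in># S" "?R S = (case d of dst_n u \<Rightarrow> insert (a, u) (?R S') | dst_r r \<Rightarrow> ?R S')"
    for a d
  proof (cases d)
    case (dst_n u)
    have "(v, a) \<notin> ?R S" for v
      using childless_if_zero_counter[OF converse_rtranclp_into_rtranclp[OF step.hyps]]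
        step.prems that(1) by auto
    \<comment> \<open>A cycle through the new edge \<open>(a, u)\<close> would need a path from
      \<open>u\<close> back to \<open>a\<close>, but no edge ends in \<open>a\<close>.\<close>
    then have "u \<noteq> a" "(v, a) \<notin> ?R S'" for v
      using that(2) dst_n by auto
    then have "(u, a) \<notin> (?R S')\<^sup>*"
      by (meson rtranclE)
    then show ?thesis
      using IH that(2) dst_n by simp
  qed (use IH that(2) in simp)
  from step.hyps(1) show ?case
  proof cases
    case (pgnz k a d n \<Delta>)
    then show ?thesis
      by (intro erase[of a d]) (auto split: place_dst.split)
  next
    case (pgns k n' a d n \<Delta>)
    then show ?thesis
      by (intro erase[of a d]) (auto split: place_dst.split)
  \<comment> \<open>The remaining rules leave the \<open>prnt\<close> facts between nodes
    unchanged.\<close>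
  qed (use IH in \<open>simp_all\<close>)
qed

section \<open>Decoding a set of facts\<close>

text \<open>Isolates what decoding needs, free of any mention of rewriting. A plain set suffices
  because validity fixes all multiplicities to one.\<close>

locale bigraph_facts =
  fixes \<Sigma> :: "'k signature"
    and A :: "('nd, 'rt, 'st, 'pt, 'on, 'im, 'ed, 'k) fact set"
  assumes finite_facts: "finite A"
    and vp_free: "vp a n \<notin> A"
    and lc_controls: "lc a k \<in> A \<Longrightarrow> k \<in> controls \<Sigma>"
    and lc_ex1: "is_node a \<in> A \<Longrightarrow> \<exists>!k. lc a k \<in> A"
    and lc_node: "lc a k \<in> A \<Longrightarrow> is_node a \<in> A"
    and prnt_ex1: "place_src_fact s \<in> A \<Longrightarrow> \<exists>!d. prnt s d \<in> A"
    and prnt_src: "prnt s d \<in> A \<Longrightarrow> place_src_fact s \<in> A"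
    and prnt_dst: "prnt s d \<in> A \<Longrightarrow> place_dst_fact d \<in> A"
    and link_ex1: "link_src_fact s' \<in> A \<Longrightarrow> \<exists>!d. link s' d \<in> A"
    and link_src: "link s' d' \<in> A \<Longrightarrow> link_src_fact s' \<in> A"
    and link_dst: "link s' d' \<in> A \<Longrightarrow> link_dst_fact d' \<in> A"
    and has_child_p_iff:
      "has_child_p d n \<in> A \<longleftrightarrow> place_dst_fact d \<in> A \<and> n = card {s. prnt s d \<in> A}"
    and has_child_l_iff:
      "has_child_l d' n \<in> A \<longleftrightarrow> link_dst_fact d' \<in> A \<and> n = card {s. link s d' \<in> A}"
    and lp_ex1: "is_port p \<in> A \<Longrightarrow> \<exists>!a. lp p a \<in> A"
    and lp_port: "lp p a \<in> A \<Longrightarrow> is_port p \<in> A"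
    and lp_node: "lp p a \<in> A \<Longrightarrow> is_node a \<in> A"
    and card_lp: "lc a k \<in> A \<Longrightarrow> card {p. lp p a \<in> A} = arity \<Sigma> k"
    and acyclic_prnt: "acyclic {(v, u). prnt (src_n v) (dst_n u) \<in> A}"
begin

lemma finite_preimage: "inj g \<Longrightarrow> finite {x. g x \<in> A}"
  using finite_vimageI[OF finite_facts, of g] by (simp add: vimage_def)

text \<open>The names themselves serve as nodes, edges, inner and outer names, so the naming is the
  identity there. Only roots, sites and the ports of each node have to be numbered.\<close>

lemma exists_bigraph:
  "\<exists>(B :: ('nd, 'ed, 'im, 'on, 'k) bigraph)
     (\<nu> :: ('nd, 'ed, 'im, 'on, 'nd, 'rt, 'st, 'pt, 'on, 'im, 'ed) naming).
     is_bigraph \<Sigma> B \<and> injective_naming \<Sigma> B \<nu> \<and> encoding_facts \<Sigma> \<nu> B = A"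
proof -
  obtain rn m where rn: "bij_betw rn {..<m :: nat} {r. is_root r \<in> A}"
    using ex_bij_betw_nat_finite[OF finite_preimage[of is_root]]
    by (auto simp: inj_def lessThan_atLeast0)
  obtain sn l where sn: "bij_betw sn {..<l :: nat} {t. is_site t \<in> A}"
    using ex_bij_betw_nat_finite[OF finite_preimage[of is_site]]
    by (auto simp: inj_def lessThan_atLeast0)
  define ct where "ct v = (THE k. lc v k \<in> A)" for v
  have lc_iff: "lc v k \<in> A \<longleftrightarrow> is_node v \<in> A \<and> k = ct v" for v k
    unfolding ct_def using lc_ex1[of v] lc_node[of v] by (metis the_equality)
  \<comment> \<open>By \<open>card_lp\<close> the ports of \<open>v\<close> can be indexed by the
    numbers below its arity; \<open>pn\<close> collects these choices into one port naming.\<close>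
  have "\<exists>h. bij_betw h {..<arity \<Sigma> (ct v)} {p. lp p v \<in> A}" if "is_node v \<in> A" for v
    using ex_bij_betw_nat_finite[OF finite_preimage[of "\<lambda>p. lp p v"]] card_lp[of v "ct v"] that
    by (auto simp: inj_def lessThan_atLeast0 lc_iff)
  then obtain h where h: "\<And>v. is_node v \<in> A \<Longrightarrow> bij_betw (h v) {..<arity \<Sigma> (ct v)} {p. lp p v \<in> A}"
    by metis
  define pn where "pn = (\<lambda>(v, i). h v i)"
  define N where "N = {v. is_node v \<in> A}"
  define E where "E = {e. is_e_name e \<in> A}"
  define X where "X = {x. is_i_name x \<in> A}"
  define Y where "Y = {y. is_o_name y \<in> A}"
  define P where "P = {(v, i). v \<in> N \<and> i < arity \<Sigma> (ct v)}"
  define \<nu> :: "('nd, 'ed, 'im, 'on, 'nd, 'rt, 'st, 'pt, 'on, 'im, 'ed) naming" where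
    "\<nu> = \<lparr>node_name = id, root_name = rn, site_name = sn, port_name = pn,
          outer_name = id, inner_name = id, edge_name = id\<rparr>"
  have lp_iff: "lp p v \<in> A \<longleftrightarrow> (\<exists>i. (v, i) \<in> P \<and> p = pn (v, i))" for p v
    using h[of v] lp_node[of p v] by (auto simp: P_def N_def pn_def bij_betw_def image_iff set_eq_iff)
  have is_port_iff: "is_port p \<in> A \<longleftrightarrow> (\<exists>q\<in>P. p = pn q)" for p
    using lp_ex1[of p] lp_port[of p] lp_iff by (metis old.prod.exhaust)
  \<comment> \<open>A port belongs to only one node, so equal port names give equal nodes;
    injectivity of \<open>h v\<close> then gives equal indices.\<close>
  have pn_inj: "inj_on pn P"
  proof (rule inj_onI, clarify)
    fix v i u j
    assume *: "(v, i) \<in> P" "(u, j) \<in> P" "pn (v, i) = pn (u, j)"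
    then have "lp (pn (v, i)) v \<in> A" "lp (pn (v, i)) u \<in> A"
      using lp_iff by metis+
    then have "v = u"
      using lp_ex1[of "pn (v, i)"] lp_port by blast
    moreover from this have "i = j"
      using * h[of v] by (auto simp: P_def N_def pn_def bij_betw_def inj_on_def)
    ultimately show "v = u \<and> i = j" by simp
  qed
  \<comment> \<open>\<open>ps\<close> and \<open>ls\<close> do for sources what
    \<open>name_place_dst\<close> and \<open>name_link_dst\<close> do for destinations.\<close>
  define ps :: "'nd + nat \<Rightarrow> ('nd, 'st) place_src" where "ps = case_sum src_n (\<lambda>t. src_s (sn t))"
  define ls :: "'im + 'nd \<times> nat \<Rightarrow> ('im, 'pt) link_src" where "ls = case_sum src_i (\<lambda>q. src_p (pn q))"
  define W D Q C where sum_defs: "W = N <+> {..<l}" "D = N <+> {..<m}" "Q = X <+> P" "C = E <+> Y"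
  have bex_Plus: "(\<exists>w\<in>U <+> V. \<phi> w) \<longleftrightarrow> (\<exists>u\<in>U. \<phi> (Inl u)) \<or> (\<exists>v\<in>V. \<phi> (Inr v))"
    for U :: "'x set" and V :: "'y set" and \<phi>
    by auto
  have is_root_iff: "is_root r \<in> A \<longleftrightarrow> (\<exists>i<m. r = rn i)" for r
    using rn by (auto simp: bij_betw_def set_eq_iff image_iff Bex_def)
  have is_site_iff: "is_site t \<in> A \<longleftrightarrow> (\<exists>i<l. t = sn i)" for t
    using sn by (auto simp: bij_betw_def set_eq_iff image_iff Bex_def)
  \<comment> \<open>The four bijections \<open>pd\<close>, \<open>ps\<close>, \<open>ld\<close>,
    \<open>ls\<close> identify the elements of the future bigraph with the references declared in
    \<open>A\<close>.\<close>
  have pd: "bij_betw (name_place_dst \<nu>) D {d. place_dst_fact d \<in> A}"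
  proof (rule bij_betw_imageI)
    show "inj_on (name_place_dst \<nu>) D"
      using rn by (auto simp: sum_defs inj_on_def name_place_dst_def \<nu>_def bij_betw_def)
    have "d \<in> name_place_dst \<nu> ` D \<longleftrightarrow> place_dst_fact d \<in> A" for d
      by (cases d) (auto simp: image_iff bex_Plus sum_defs name_place_dst_def \<nu>_def N_def is_root_iff)
    then show "name_place_dst \<nu> ` D = {d. place_dst_fact d \<in> A}"
      by blast
  qed
  have ps: "bij_betw ps W {s. place_src_fact s \<in> A}"
  proof (rule bij_betw_imageI)
    show "inj_on ps W"
      using sn by (auto simp: sum_defs inj_on_def ps_def bij_betw_def)
    have "s \<in> ps ` W \<longleftrightarrow> place_src_fact s \<in> A" for s
      by (cases s) (auto simp: image_iff bex_Plus sum_defs ps_def N_def is_site_iff)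
    then show "ps ` W = {s. place_src_fact s \<in> A}"
      by blast
  qed
  have ld: "bij_betw (name_link_dst \<nu>) C {d. link_dst_fact d \<in> A}"
  proof (rule bij_betw_imageI)
    show "inj_on (name_link_dst \<nu>) C"
      by (auto simp: sum_defs inj_on_def name_link_dst_def \<nu>_def)
    have "d \<in> name_link_dst \<nu> ` C \<longleftrightarrow> link_dst_fact d \<in> A" for d
      by (cases d) (auto simp: image_iff bex_Plus sum_defs name_link_dst_def \<nu>_def E_def Y_def)
    then show "name_link_dst \<nu> ` C = {d. link_dst_fact d \<in> A}"
      by blast
  qed
  have ls: "bij_betw ls Q {s. link_src_fact s \<in> A}"
  proof (rule bij_betw_imageI)
    show "inj_on ls Q"
      by (rule inj_onI) (auto simp: sum_defs ls_def dest!: inj_onD[OF pn_inj])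
    have "s \<in> ls ` Q \<longleftrightarrow> link_src_fact s \<in> A" for s
      by (cases s) (auto simp: image_iff bex_Plus sum_defs ls_def X_def is_port_iff)
    then show "ls ` Q = {s. link_src_fact s \<in> A}"
      by blast
  qed
  define pm where "pm w = inv_into D (name_place_dst \<nu>) (THE d. prnt (ps w) d \<in> A)" for w
  define lm where "lm q = inv_into C (name_link_dst \<nu>) (THE d. link (ls q) d \<in> A)" for q
  have pm: "pm w \<in> D \<and> (\<forall>d. prnt (ps w) d \<in> A \<longleftrightarrow> d = name_place_dst \<nu> (pm w))" if "w \<in> W" for w
  proof -
    obtain d where d: "\<And>d'. prnt (ps w) d' \<in> A \<longleftrightarrow> d' = d"
      using prnt_ex1[of "ps w"] bij_betwE[OF ps] \<open>w \<in> W\<close> by blast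
    then have "d \<in> name_place_dst \<nu> ` D"
      using prnt_dst bij_betw_imp_surj_on[OF pd] by blast
    then show ?thesis
      unfolding pm_def d by (simp add: f_inv_into_f inv_into_into)
  qed
  have lm: "lm q \<in> C \<and> (\<forall>d. link (ls q) d \<in> A \<longleftrightarrow> d = name_link_dst \<nu> (lm q))" if "q \<in> Q" for q
  proof -
    obtain d where d: "\<And>d'. link (ls q) d' \<in> A \<longleftrightarrow> d' = d"
      using link_ex1[of "ls q"] bij_betwE[OF ls] \<open>q \<in> Q\<close> by blast
    then have "d \<in> name_link_dst \<nu> ` C"
      using link_dst bij_betw_imp_surj_on[OF ld] by blast
    then show ?thesis
      unfolding lm_def d by (simp add: f_inv_into_f inv_into_into)
  qed
  define B :: "('nd, 'ed, 'im, 'on, 'k) bigraph" where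
    "B = \<lparr>num_sites = l, num_roots = m, inner_names = X, outer_names = Y, nodes = N, edges = E,
          ctrl_map = ct, prnt_map = pm, link_map = lm\<rparr>"
  have P: "ports \<Sigma> B = P"
    by (simp add: ports_def B_def P_def)
  \<comment> \<open>Nodes are their own names, so the parent ordering of \<open>B\<close> lies
    inside the acyclic relation of \<open>A\<close>.\<close>
  have "prnt (src_n v) (dst_n u) \<in> A" if "v \<in> N" "pm (Inl v) = Inl u" for u v
    using pm[of "Inl v"] that by (auto simp: sum_defs ps_def name_place_dst_def \<nu>_def)
  then have "acyclic {(v, u). v \<in> N \<and> u \<in> N \<and> pm (Inl v) = Inl u}"
    by (intro acyclic_subset[OF acyclic_prnt]) auto
  moreover have "finite X" "finite Y" "finite N" "finite E"
    by (auto simp: X_def Y_def N_def E_def inj_def intro!: finite_preimage)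
  ultimately have "is_bigraph \<Sigma> B"
    using pm lm lc_controls lc_iff unfolding is_bigraph_def P by (simp add: B_def sum_defs) (simp add: N_def)
  moreover have "injective_naming \<Sigma> B \<nu>"
    using rn sn pn_inj unfolding injective_naming_def P by (simp add: B_def \<nu>_def bij_betw_def)
  moreover have "encoding_facts \<Sigma> \<nu> B = A"
  proof -
    have prnt_iff: "prnt s d \<in> A \<longleftrightarrow> (\<exists>w\<in>W. s = ps w \<and> d = name_place_dst \<nu> (pm w))" for s d
    proof
      assume *: "prnt s d \<in> A"
      then obtain w where "w \<in> W" "s = ps w"
        using prnt_src bij_betw_imp_surj_on[OF ps] by blast
      with * show "\<exists>w\<in>W. s = ps w \<and> d = name_place_dst \<nu> (pm w)"
        using pm by auto
    qed (use pm in auto)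
    have link_iff: "link s d \<in> A \<longleftrightarrow> (\<exists>q\<in>Q. s = ls q \<and> d = name_link_dst \<nu> (lm q))" for s d
    proof
      assume *: "link s d \<in> A"
      then obtain q where "q \<in> Q" "s = ls q"
        using link_src bij_betw_imp_surj_on[OF ls] by blast
      with * show "\<exists>q\<in>Q. s = ls q \<and> d = name_link_dst \<nu> (lm q)"
        using lm by auto
    qed (use lm in auto)
    \<comment> \<open>\<open>ps\<close> maps the preimage onto these sources; injectivity of the
      naming on \<open>D\<close> rules out further sources sharing the destination name.\<close>
    have card_p: "card (prnt_preimage B d) = card {s. prnt s (name_place_dst \<nu> d) \<in> A}"
      if "d \<in> D" for d
    proof (rule bij_betw_same_card[of ps], rule bij_betw_imageI)
      have *: "prnt_preimage B d = {w \<in> W. pm w = d}"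
        by (simp add: prnt_preimage_def B_def sum_defs)
      show "inj_on ps (prnt_preimage B d)"
        using bij_betw_imp_inj_on[OF ps] by (rule inj_on_subset) (simp add: *)
      have "name_place_dst \<nu> d = name_place_dst \<nu> (pm w) \<longleftrightarrow> pm w = d" if "w \<in> W" for w
        using inj_on_eq_iff[OF bij_betw_imp_inj_on[OF pd]] \<open>d \<in> D\<close> pm[OF that] by metis
      then show "ps ` prnt_preimage B d = {s. prnt s (name_place_dst \<nu> d) \<in> A}"
        unfolding * prnt_iff by blast
    qed
    have card_l: "card (link_preimage \<Sigma> B d) = card {s. link s (name_link_dst \<nu> d) \<in> A}"
      if "d \<in> C" for d
    proof (rule bij_betw_same_card[of ls], rule bij_betw_imageI)
      have *: "link_preimage \<Sigma> B d = {q \<in> Q. lm q = d}"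
        by (simp add: link_preimage_def P sum_defs) (simp add: B_def)
      show "inj_on ls (link_preimage \<Sigma> B d)"
        using bij_betw_imp_inj_on[OF ls] by (rule inj_on_subset) (simp add: *)
      have "name_link_dst \<nu> d = name_link_dst \<nu> (lm q) \<longleftrightarrow> lm q = d" if "q \<in> Q" for q
        using inj_on_eq_iff[OF bij_betw_imp_inj_on[OF ld]] \<open>d \<in> C\<close> lm[OF that] by metis
      then show "ls ` link_preimage \<Sigma> B d = {s. link s (name_link_dst \<nu> d) \<in> A}"
        unfolding * link_iff by blast
    qed
    have p_iff: "has_child_p d n \<in> A \<longleftrightarrow>
        (\<exists>d'\<in>D. d = name_place_dst \<nu> d' \<and> n = card (prnt_preimage B d'))" for d n
      using card_p bij_betw_imp_surj_on[OF pd] unfolding has_child_p_iff by auto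
    have l_iff: "has_child_l d n \<in> A \<longleftrightarrow>
        (\<exists>d'\<in>C. d = name_link_dst \<nu> d' \<and> n = card (link_preimage \<Sigma> B d'))" for d n
      using card_l bij_betw_imp_surj_on[OF ld] unfolding has_child_l_iff by auto
    have "f \<in> encoding_facts \<Sigma> \<nu> B \<longleftrightarrow> f \<in> A" for f
    proof (cases f)
      case (prnt s d)
      then show ?thesis
        by (auto simp: prnt_iff bex_Plus sum_defs ps_def encoding_facts_def P) (auto simp: B_def \<nu>_def)
    next
      case (link s d)
      then show ?thesis
        by (auto simp: link_iff bex_Plus sum_defs ls_def encoding_facts_def P) (auto simp: B_def \<nu>_def)
    next
      case (has_child_p d n)
      then show ?thesis
        by (auto simp: p_iff bex_Plus sum_defs encoding_facts_def name_place_dst_def) (auto simp: B_def \<nu>_def)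
    next
      case (has_child_l d n)
      then show ?thesis
        by (auto simp: l_iff bex_Plus sum_defs encoding_facts_def name_link_dst_def) (auto simp: B_def \<nu>_def)
    next
      case (is_port p)
      then show ?thesis
        by (auto simp: encoding_facts_def P is_port_iff \<nu>_def)
    next
      case (lp p a)
      then show ?thesis
        by (auto simp: encoding_facts_def P lp_iff \<nu>_def)
    \<comment> \<open>Among the remaining kinds is \<open>vp\<close>, absent from every encoding and
      from \<open>A\<close> by \<open>vp_free\<close>.\<close>
    qed (auto simp: encoding_facts_def B_def \<nu>_def N_def E_def X_def Y_def lc_iff vp_free
           is_root_iff is_site_iff)
    then show ?thesis
      by blast
  qed
  ultimately show ?thesis
    by blast
qed

end

section \<open>From validity to the decoding conditions\<close>

theorem theorem1:
  fixes \<Sigma> :: "'k signature"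
    and S :: "('nd, 'rt, 'st, 'pt, 'on, 'im, 'ed, 'k) fact multiset"
  assumes "over_signature \<Sigma> S"
    and "\<forall>a n. vp a n \<notin># S"
    and "valid \<Sigma> S"
  shows "\<exists>(B :: ('nd, 'ed, 'im, 'on, 'k) bigraph) \<nu>.
           is_bigraph \<Sigma> B \<and> injective_naming \<Sigma> B \<nu> \<and> encoding \<Sigma> \<nu> B = S"
proof -
  have erasable: "(rewrite \<Sigma>)\<^sup>*\<^sup>* S {#}" and count: "\<And>f. f \<in># S \<Longrightarrow> count S f = 1"
    using assms(3) by (auto simp: valid_def)
  let ?A = "set_mset S"
  have S: "S = mset_set ?A"
    using count by (intro multiset_eqI) (metis count_mset_set(1,3) finite_set_mset not_in_iff)
  \<comment> \<open>Multiplicity one turns the sizes in the invariants into cardinalities.\<close>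
  have size: "size {#f \<in># S. f \<in> range g#} = card {x. g x \<in># S}" if "inj g"
    for g :: "'a \<Rightarrow> ('nd, 'rt, 'st, 'pt, 'on, 'im, 'ed, 'k) fact"
  proof -
    have "size {#f \<in># S. f \<in> range g#} = card {f \<in> ?A. f \<in> range g}"
      by (subst S) simp
    also have "{f \<in> ?A. f \<in> range g} = g ` {x. g x \<in># S}"
      by auto
    also have "card \<dots> = card {x. g x \<in># S}"
      using that by (intro card_image) (blast intro: inj_on_subset)
    finally show ?thesis .
  qed
  have ex1: "\<exists>!x. g x \<in># S" if "size {#f \<in># S. f \<in> range g#} = count S h" "inj g" "h \<in># S"
    for g :: "'a \<Rightarrow> ('nd, 'rt, 'st, 'pt, 'on, 'im, 'ed, 'k) fact" and h
    using that by (auto simp: size count card_1_singleton_iff set_eq_iff)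
  have head: "h \<in># S" if "size {#f \<in># S. f \<in> range g#} = count S h" "g x \<in># S"
    for g :: "'a \<Rightarrow> ('nd, 'rt, 'st, 'pt, 'on, 'im, 'ed, 'k) fact" and h x
  proof (rule ccontr)
    assume "h \<notin># S"
    then have "size {#f \<in># S. f \<in> range g#} = 0"
      using that(1) by (simp only: not_in_iff)
    with that(2) show False
      by auto
  qed
  \<comment> \<open>Used to show that references do not dangle: a fact pointing at a target forces a
    fact of non-zero weight, and this one in turn leads to the declaration of the target.\<close>
  have positive: "\<exists>f\<in>#S. w f \<noteq> 0"
    if "size {#f \<in># S. f \<in> range g#} = (\<Sum>f\<in>#S. w f)" "g x \<in># S"
    for g :: "'a \<Rightarrow> ('nd, 'rt, 'st, 'pt, 'on, 'im, 'ed, 'k) fact" and w :: "_ \<Rightarrow> nat" and x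
  proof (rule ccontr)
    assume "\<not> ?thesis"
    then have "(\<Sum>f\<in>#S. w f) = 0"
      by simp
    with that show False
      by auto
  qed
  have place_ex1: "\<exists>!n. has_child_p d n \<in># S" if "place_dst_fact d \<in># S" for d
    using that by (intro ex1[OF has_child_p_count[OF erasable]]) (auto simp: inj_def)
  have place_card: "card {s. prnt s d \<in># S} = n" if "has_child_p d n \<in># S" for d n
  proof -
    \<comment> \<open>Validity makes the counter at \<open>d\<close> unique, so the sum of weights
      reduces to its value \<open>n\<close>.\<close>
    have "place_weight d f = 0" if "f \<in># S" "f \<noteq> has_child_p d n" for f
      using assms(3) that \<open>has_child_p d n \<in># S\<close> by (cases f) (auto simp: valid_def)
    then have "(\<Sum>f\<in>#S. place_weight d f) = n"
      using sum_mset_only[of "has_child_p d n" S "place_weight d"] that count by simp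
    then show ?thesis
      using place_weight_sum[OF erasable] size[of "\<lambda>s. prnt s d"] by (simp add: inj_def)
  qed
  have place_dst: "place_dst_fact d \<in># S" if "prnt s d \<in># S" for s d
  proof -
    have "\<exists>f\<in>#S. place_weight d f \<noteq> 0"
      using positive[of "\<lambda>s. prnt s d" "place_weight d" s] place_weight_sum[OF erasable] that by blast
    then obtain f where "f \<in># S" "place_weight d f \<noteq> 0"
      by blast
    then obtain n where "has_child_p d n \<in># S"
      by (cases f) (auto split: if_splits)
    then show ?thesis
      by (rule head[OF has_child_p_count[OF erasable]])
  qed
  have link_ex1: "\<exists>!n. has_child_l d n \<in># S" if "link_dst_fact d \<in># S" for d
    using that by (intro ex1[OF has_child_l_count[OF erasable]]) (auto simp: inj_def)
  have link_card: "card {s. link s d \<in># S} = n" if "has_child_l d n \<in># S" for d n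
  proof -
    have "link_weight d f = 0" if "f \<in># S" "f \<noteq> has_child_l d n" for f
      using assms(3) that \<open>has_child_l d n \<in># S\<close> by (cases f) (auto simp: valid_def)
    then have "(\<Sum>f\<in>#S. link_weight d f) = n"
      using sum_mset_only[of "has_child_l d n" S "link_weight d"] that count by simp
    then show ?thesis
      using link_weight_sum[OF erasable] size[of "\<lambda>s. link s d"] by (simp add: inj_def)
  qed
  have link_dst: "link_dst_fact d \<in># S" if "link s d \<in># S" for s d
  proof -
    have "\<exists>f\<in>#S. link_weight d f \<noteq> 0"
      using positive[of "\<lambda>s. link s d" "link_weight d" s] link_weight_sum[OF erasable] that by blast
    then obtain f where "f \<in># S" "link_weight d f \<noteq> 0"
      by blast
    then obtain n where "has_child_l d n \<in># S"
      by (cases f) (auto split: if_splits)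
    then show ?thesis
      by (rule head[OF has_child_l_count[OF erasable]])
  qed
  have lc_node: "is_node a \<in># S" if "lc a k \<in># S" for a k
    using head[OF lc_count[OF erasable]] that by blast
  have lc_ex1: "\<exists>!k. lc a k \<in># S" if "is_node a \<in># S" for a
    using that by (intro ex1[OF lc_count[OF erasable]]) (auto simp: inj_def)
  have port_card: "card {p. lp p a \<in># S} = arity \<Sigma> k" if "lc a k \<in># S" for a k
  proof -
    \<comment> \<open>Without \<open>vp\<close> facts only control facts carry weight, and
      \<open>a\<close> has just one of these.\<close>
    have "port_weight \<Sigma> a f = 0" if "f \<in># S" "f \<noteq> lc a k" for f
      using assms(2) lc_ex1[OF lc_node[OF \<open>lc a k \<in># S\<close>]] that \<open>lc a k \<in># S\<close> by (cases f) auto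
    then have "(\<Sum>f\<in>#S. port_weight \<Sigma> a f) = arity \<Sigma> k"
      using sum_mset_only[of "lc a k" S "port_weight \<Sigma> a"] that count by simp
    then show ?thesis
      using port_weight_sum[OF erasable] size[of "\<lambda>p. lp p a"] by (simp add: inj_def)
  qed
  have lp_node: "is_node a \<in># S" if "lp p a \<in># S" for p a
  proof -
    have "\<exists>f\<in>#S. port_weight \<Sigma> a f \<noteq> 0"
      using positive[of "\<lambda>p. lp p a" "port_weight \<Sigma> a" p] port_weight_sum[OF erasable] that by blast
    then obtain f where "f \<in># S" "port_weight \<Sigma> a f \<noteq> 0"
      by blast
    \<comment> \<open>As \<open>vp\<close> is absent, \<open>f\<close> must be a control fact of
      \<open>a\<close>.\<close>
    then show ?thesis
      using assms(2) lc_node by (cases f) (auto split: if_splits)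
  qed
  have "bigraph_facts \<Sigma> ?A"
  proof
    show "has_child_p d n \<in># S \<longleftrightarrow> place_dst_fact d \<in># S \<and> n = card {s. prnt s d \<in># S}" for d n
      using place_ex1[of d] place_card[of d] head[OF has_child_p_count[OF erasable], of d] by metis
    show "has_child_l d n \<in># S \<longleftrightarrow> link_dst_fact d \<in># S \<and> n = card {s. link s d \<in># S}" for d n
      using link_ex1[of d] link_card[of d] head[OF has_child_l_count[OF erasable], of d] by metis
    show "k \<in> controls \<Sigma>" if "lc a k \<in># S" for a k
      using assms(1) that by (auto simp: over_signature_def)
    show "\<exists>!d. prnt s d \<in># S" if "place_src_fact s \<in># S" for s
      using that by (intro ex1[OF prnt_count[OF erasable]]) (auto simp: inj_def)
    show "\<exists>!d. link s d \<in># S" if "link_src_fact s \<in># S" for s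
      using that by (intro ex1[OF link_count[OF erasable]]) (auto simp: inj_def)
    show "\<exists>!a. lp p a \<in># S" if "is_port p \<in># S" for p
      using that by (intro ex1[OF lp_count[OF erasable]]) (auto simp: inj_def)
    show "place_src_fact s \<in># S" if "prnt s d \<in># S" for s d
      using head[OF prnt_count[OF erasable]] that by blast
    show "link_src_fact s \<in># S" if "link s d \<in># S" for s d
      using head[OF link_count[OF erasable]] that by blast
    show "is_port p \<in># S" if "lp p a \<in># S" for p a
      using head[OF lp_count[OF erasable]] that by blast
    show "acyclic {(v, u). prnt (src_n v) (dst_n u) \<in># S}"
      \<comment> \<open>The bound on \<open>is_node\<close> also covers undeclared nodes, whose
        count is zero.\<close>
      using acyclic_parents[OF erasable] count
      by (metis One_nat_def le_SucI le_refl not_in_iff zero_le)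
  qed (use assms(2) lc_ex1 lc_node place_dst link_dst lp_node port_card in auto)
  from bigraph_facts.exists_bigraph[OF this] show ?thesis
    unfolding encoding_def by (metis S)
qed

end
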